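(* Let $Q_{4n}=\langle a,b\mid a^n=b^2,\ a^{2n}=e,\ b^{-1}ab=a^{-1}\rangle$ be the generalized quaternion group of order $4n\ge 8$, and let $H$ be a proper subgroup of $Q_{4n}$. Then the following statements hold for any integer $k$ between $1$ and $|H|$ (inclusive): (a) if $k$ is even, then $H$ is a $(0,k)$-regular set of $Q_{4n}$; (b) if $k$ is odd, then $H$ is a $(0,k)$-regular set of $Q_{4n}$ if and only if either $H=\langle a^t\rangle$ with $t$ a divisor of $2n$ such that $\frac{2n}{t}$ is odd, or $H=\langle a^t,a^sb\rangle$ with $t$ an odd divisor of $2n$ and $0\le s\le t-1$.
   Context: For a finite group $G$ with identity $e$ and an inverse-closed subset $S$ of $G\setminus\{e\}$ (i.e. $S^{-1}=S$), $\mathrm{Cay}(G,S)$ is the graph with vertex set $G$ and edge set $\{\{x,y\}: x,y\in G,\ yx^{-1}\in S\}$. A $(0,k)$-regular set in a graph $\Gamma$ is a nonempty proper subset $D$ of $V(\Gamma)$ such that every vertex in $D$ has no neighbour in $D$ and every vertex in $V(\Gamma)\setminus D$ has exactly $k$ neighbours in $D$. A subset $D$ of a group $G$ is a $(0,k)$-regular set of $G$ if it is a $(0,k)$-regular set in $\mathrm{Cay}(G,S)$ for some inverse-closed $S\subseteq G\setminus\{e\}$. *)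

theory Defs
  imports "HOL-Algebra.Generated_Groups"
begin

(* A word is a list of letters; (x, True) stands for the generator x and (x, False) for
   its formal inverse. *)
type_synonym 'x word = "('x \<times> bool) list"

(* word_eq R u v: u and v represent the same element of the group with generating set the
   whole type 'x and a defining relation l = r for every (l, r) in R, i.e. they are related
   by the congruence on words generated by free cancellation and R. *)
inductive word_eq :: "('x word \<times> 'x word) set \<Rightarrow> 'x word \<Rightarrow> 'x word \<Rightarrow> bool"
  for R where
  refl: "word_eq R u u"
| sym: "word_eq R u v \<Longrightarrow> word_eq R v u"
| trans: "word_eq R u v \<Longrightarrow> word_eq R v w \<Longrightarrow> word_eq R u w"
| cancel: "word_eq R (u @ [(x, i), (x, \<not> i)] @ v) (u @ v)"
| relation: "(l, r) \<in> R \<Longrightarrow> word_eq R (u @ l @ v) (u @ r @ v)"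

primrec word_val :: "('a, 'c) monoid_scheme \<Rightarrow> ('x \<Rightarrow> 'a) \<Rightarrow> 'x word \<Rightarrow> 'a" where
  "word_val G f [] = \<one>\<^bsub>G\<^esub>"
| "word_val G f (p # w) =
     (if snd p then f (fst p) else inv\<^bsub>G\<^esub> (f (fst p))) \<otimes>\<^bsub>G\<^esub> word_val G f w"

(* G is the group presented by the generators f x and the relations R: the f x generate G,
   and two words have equal values exactly when R forces it. *)
definition has_presentation ::
  "('a, 'c) monoid_scheme \<Rightarrow> ('x \<Rightarrow> 'a) \<Rightarrow> ('x word \<times> 'x word) set \<Rightarrow> bool" where
  "has_presentation G f R \<longleftrightarrow>
     group G \<and> range f \<subseteq> carrier G \<and> generate G (range f) = carrier G \<and>
     (\<forall>u v. word_val G f u = word_val G f v \<longleftrightarrow> word_eq R u v)"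

datatype quat_gen = GenA | GenB

(* a^n = b^2, a^(2n) = e, b^(-1) a b = a^(-1) *)
definition quat_relations :: "nat \<Rightarrow> (quat_gen word \<times> quat_gen word) set" where
  "quat_relations n =
     {(replicate n (GenA, True), [(GenB, True), (GenB, True)]),
      (replicate (2 * n) (GenA, True), []),
      ([(GenB, False), (GenA, True), (GenB, True)], [(GenA, False)])}"

definition generalized_quaternion ::
  "('a, 'c) monoid_scheme \<Rightarrow> 'a \<Rightarrow> 'a \<Rightarrow> nat \<Rightarrow> bool" where
  "generalized_quaternion G a b n \<longleftrightarrow>
     has_presentation G (case_quat_gen a b) (quat_relations n)"

definition cayley_edges :: "('a, 'c) monoid_scheme \<Rightarrow> 'a set \<Rightarrow> 'a set set" where
  "cayley_edges G S =
     {{x, y} | x y. x \<in> carrier G \<and> y \<in> carrier G \<and> y \<otimes>\<^bsub>G\<^esub> inv\<^bsub>G\<^esub> x \<in> S}"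

(* (0,k)-regular set D in the graph with vertex set V and edge set E *)
definition zero_regular_set :: "'v set \<Rightarrow> 'v set set \<Rightarrow> nat \<Rightarrow> 'v set \<Rightarrow> bool" where
  "zero_regular_set V E k D \<longleftrightarrow>
     D \<noteq> {} \<and> D \<subset> V \<and>
     (\<forall>v\<in>D. \<not> (\<exists>u\<in>D. {v, u} \<in> E)) \<and>
     (\<forall>v\<in>V - D. card {u \<in> D. {v, u} \<in> E} = k)"

definition group_zero_regular_set ::
  "('a, 'c) monoid_scheme \<Rightarrow> nat \<Rightarrow> 'a set \<Rightarrow> bool" where
  "group_zero_regular_set G k D \<longleftrightarrow>
     (\<exists>S \<subseteq> carrier G - {\<one>\<^bsub>G\<^esub>}. (\<lambda>s. inv\<^bsub>G\<^esub> s) ` S = S \<and>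
        zero_regular_set (carrier G) (cayley_edges G S) k D)"

(* For every R the presented group exists (as a group on words), so the
   presentation hypothesis is satisfiable. *)

lemma word_eq_append: "word_eq R u v \<Longrightarrow> word_eq R (p @ u @ q) (p @ v @ q)"
proof (induction rule: word_eq.induct)
  case (cancel u x i v) show ?case using word_eq.cancel[of R "p@u" x i "v@q"] by simp
next
  case (relation l r u v) thus ?case using word_eq.relation[of l r R "p@u" "v@q"] by simp
qed (blast intro: word_eq.intros)+

lemma word_eq_append2: "word_eq R u u' \<Longrightarrow> word_eq R v v' \<Longrightarrow> word_eq R (u @ v) (u' @ v')"
  using word_eq_append[of R u u' "[]" v] word_eq_append[of R v v' u' "[]"]
  by (auto intro: word_eq.trans)

definition winv :: "'x word \<Rightarrow> 'x word" where
  "winv w = rev (map (\<lambda>(x,i). (x, \<not> i)) w)"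

lemma winv: "word_eq R (winv w @ w) []"
proof (induction w)
  case Nil show ?case by (simp add: winv_def word_eq.refl)
next
  case (Cons p w)
  obtain x i where p: "p = (x,i)" by force
  have "word_eq R (winv w @ [(x, \<not>i),(x, \<not>\<not>i)] @ w) (winv w @ w)" by (rule word_eq.cancel)
  thus ?case using Cons p by (auto simp: winv_def intro: word_eq.trans)
qed

lemma presented_group_exists:
  fixes R :: "('x word \<times> 'x word) set"
  shows "\<exists>(G :: 'x word monoid) f. has_presentation G f R"
proof -
  define c where "c u = (SOME v. word_eq R u v)" for u
  have c: "word_eq R u (c u)" for u unfolding c_def
    using word_eq.refl[of R u] by (rule someI[where P="word_eq R u"])
  have c': "word_eq R (c u) u" for u using c word_eq.sym by blast
  have ceq: "c u = c v \<longleftrightarrow> word_eq R u v" for u v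
  proof
    assume "c u = c v" thus "word_eq R u v" using c[of u] c'[of v] by (auto intro: word_eq.trans)
  next
    assume "word_eq R u v"
    hence "word_eq R u = word_eq R v" by (auto intro!: ext intro: word_eq.trans word_eq.sym)
    thus "c u = c v" by (simp add: c_def)
  qed
  define G :: "'x word monoid" where
    "G = \<lparr>carrier = range c, mult = (\<lambda>u v. c (u @ v)), one = c []\<rparr>"
  have m: "c u \<otimes>\<^bsub>G\<^esub> c v = c (u @ v)" for u v
    unfolding G_def by (simp add: ceq) (intro word_eq_append2 c')
  have o: "\<one>\<^bsub>G\<^esub> = c []" and car: "carrier G = range c" by (simp_all add: G_def)
  interpret G: group G
  proof (rule groupI)
    fix x assume "x \<in> carrier G"
    then obtain u where u: "x = c u" by (auto simp: car)
    show "\<exists>y\<in>carrier G. y \<otimes>\<^bsub>G\<^esub> x = \<one>\<^bsub>G\<^esub>"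
      unfolding u by (rule bexI[of _ "c (winv u)"]) (auto simp: m o car ceq winv)
  qed (auto simp: car o m)
  define f where "f x = c [(x, True)]" for x
  have fi: "inv\<^bsub>G\<^esub> (f x) = c [(x, False)]" for x
    by (rule G.inv_equality)
      (use word_eq.cancel[of R "[]" x False "[]"] in \<open>auto simp: f_def m o ceq car\<close>)
  have val: "word_val G f u = c u" for u
    by (induction u) (auto simp: o fi m split: prod.splits, auto simp: f_def m)
  have fc: "range f \<subseteq> carrier G" by (auto simp: f_def car)
  have "word_val G f u \<in> generate G (range f)" for u
    by (induction u) (auto intro: generate.intros)
  hence "carrier G \<subseteq> generate G (range f)" by (auto simp: car val)
  hence "generate G (range f) = carrier G" using G.generate_incl[OF fc] by auto
  thus ?thesis unfolding has_presentation_def using fc val ceq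
    by (intro exI[of _ G] exI[of _ f]) (simp add: G.group_axioms)
qed

corollary generalized_quaternion_exists:
  "\<exists>(G :: quat_gen word monoid) a b. generalized_quaternion G a b n"
proof -
  obtain G :: "quat_gen word monoid" and f where h:
    "has_presentation G f (quat_relations n)"
    using presented_group_exists by blast
  have "case_quat_gen (f GenA) (f GenB) = f" by (auto intro!: ext split: quat_gen.splits)
  with h show ?thesis unfolding generalized_quaternion_def by metis
qed

end

(* A subgroup H is (0,k)-regular iff some inverse-closed S disjoint from H meets every
   nontrivial right coset of H in exactly k elements. Besides the identity, the only element of
   Q_4n equal to its inverse is a^n. Hence if a^n lies in H, a nontrivial coset that is closed
   under inversion forces k to be even; such a coset exists unless t is odd and
   H = <a^t, a^s b>. Conversely S is assembled from the cosets of <a^t>, which inversion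
   permutes: a coset is paired with its inverse, or an inversion-invariant subset of the required
   size is chosen in it. If <a^t> has odd order, the coset of a^n supplies a fixed point, so that
   odd sizes are available too. *)
theory Submission
  imports Complex_Main Defs
begin

section \<open>Invariant subsets of an involution\<close>

text \<open>Why odd k survives in exactly two cases: call the cosets of \<open><a^t>\<close> blocks,
  where \<open><a^t>\<close> is the set of rotations in H. Inversion moves the block of
  \<open>a^i b\<close> to that of \<open>a^(i+n) b\<close>. So the flip blocks are all self-inverse
  if t divides n and none is otherwise, and a self-inverse one only admits even sizes. A rotation
  block other than \<open><a^t>\<close> is self-inverse iff t divides 2i, which forces t to be even.
  For H = \<open><a^t>\<close> a nontrivial coset may be a single flip block, so odd k needs t not
  dividing n. For H = \<open><a^t, a^s b>\<close> the square of \<open>a^s b\<close> is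
  \<open>a^n\<close>, so t divides n and flips come in even numbers only. But each coset of H now
  joins one rotation block to one flip block, and k can be split as p + q with q even on the flips.
  An odd p on the rotations is possible exactly when t is odd. A separate obstacle is the
  presentation: relations only identify words. That \<open>a\<close> has order exactly 2n and that
  \<open>b\<close> is no power of \<open>a\<close> must be seen in a concrete model.\<close>

lemma involution_even_subset:
  assumes "finite X" "\<And>x. x \<in> X \<Longrightarrow> f x \<in> X \<and> f (f x) = x \<and> f x \<noteq> x"
    and "2 * j \<le> card X"
  shows "\<exists>T\<subseteq>X. f ` T = T \<and> card T = 2 * j"
  using assms(3)
proof (induction j)
  case 0
  show ?case by (rule exI[of _ "{}"]) simp
next
  case (Suc j)
  then obtain T where T: "T \<subseteq> X" "f ` T = T" "card T = 2 * j" by auto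
  with Suc.prems have "T \<noteq> X" by auto
  with T obtain x where x: "x \<in> X" "x \<notin> T" by blast
  have fx: "f x \<in> X" "f (f x) = x" "f x \<noteq> x" using assms(2) x by auto
  have "f x \<notin> T" using T(2) fx x by (metis imageI)
  moreover have "finite T" using T assms(1) finite_subset by blast
  ultimately have "card (insert x (insert (f x) T)) = 2 * Suc j" using T x fx by simp
  moreover have "f ` insert x (insert (f x) T) = insert x (insert (f x) T)"
    using T fx by auto
  ultimately show ?case using T x fx by (intro exI[of _ "insert x (insert (f x) T)"]) simp
qed

text \<open>In a set of size 2j + 1, an invariant subset of size 2j would leave a single point,
  which \<open>f\<close> would have to fix.\<close>

lemma involution_even_card:
  assumes "finite X" "\<And>x. x \<in> X \<Longrightarrow> f x \<in> X \<and> f (f x) = x \<and> f x \<noteq> x"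
  shows "even (card X)"
proof (rule ccontr)
  assume "odd (card X)"
  then obtain j where j: "card X = 2 * j + 1" by (rule oddE)
  then obtain T where T: "T \<subseteq> X" "f ` T = T" "card T = 2 * j"
    using involution_even_subset[OF assms, of j] by auto
  then have "card (X - T) = 1"
    using j assms(1) by (simp add: card_Diff_subset finite_subset)
  then obtain x where x: "X - T = {x}" by (rule card_1_singletonE)
  then have "x \<in> X" "x \<notin> T" by auto
  then have "f x \<in> X - T" using T(2) assms(2)[of x] by (metis DiffI imageI)
  then show False using x assms(2)[OF \<open>x \<in> X\<close>] by auto
qed

text \<open>The fixed point repairs parity: \<open>z\<close> joins a union of 2-element orbits when
  \<open>p\<close> is odd. The rest of \<open>X\<close> has even size, so
  \<open>2 * (p div 2)\<close> points fit into it even if \<open>p = card X\<close>.\<close>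

lemma involution_one_fixed_subset:
  assumes "finite X" "z \<in> X" "f z = z"
    and "\<And>x. x \<in> X \<Longrightarrow> x \<noteq> z \<Longrightarrow> f x \<in> X \<and> f (f x) = x \<and> f x \<noteq> x"
    and "p \<le> card X"
  shows "\<exists>T\<subseteq>X. f ` T = T \<and> card T = p"
proof -
  define Y where "Y = X - {z}"
  have Y: "finite Y" "card X = Suc (card Y)" using assms(1) card.remove[OF assms(1,2)] by (simp_all add: Y_def)
  have inv: "f x \<in> Y \<and> f (f x) = x \<and> f x \<noteq> x" if "x \<in> Y" for x
  proof -
    have "x \<in> X" "x \<noteq> z" using that by (simp_all add: Y_def)
    then have "f x \<in> X" "f (f x) = x" "f x \<noteq> x" using assms(4) by simp_all
    moreover from this have "f x \<noteq> z" using \<open>x \<noteq> z\<close> assms(3) by metis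
    ultimately show ?thesis by (simp add: Y_def)
  qed
  have ev: "even (card Y)" by (rule involution_even_card[of Y f, OF Y(1)]) (rule inv)
  define j where "j = p div 2"
  have "2 * j \<le> card Y" using ev Y(2) assms(5) unfolding j_def by presburger
  then obtain T where T: "T \<subseteq> Y" "f ` T = T" "card T = 2 * j"
    using involution_even_subset[of Y f j] Y(1) inv by metis
  show ?thesis
  proof (cases "even p")
    case True
    then have "card T = p" using T(3) by (simp add: j_def)
    then show ?thesis using T(1,2) unfolding Y_def by blast
  next
    case False
    have "z \<notin> T" "finite T" using T Y unfolding Y_def by (auto intro: finite_subset)
    then have "card (insert z T) = p" using T(3) False by (simp add: j_def)
    moreover have "f ` insert z T = insert z T" "insert z T \<subseteq> X"
      using T assms(2,3) unfolding Y_def by auto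
    ultimately show ?thesis by blast
  qed
qed

text \<open>\<open>f\<close> pairs up the blocks. For two distinct partners, any p-subset of one can
  be carried to the other by \<open>f\<close>; only self-paired blocks need the hypothesis
  \<open>self\<close>.\<close>

lemma invariant_selection:
  assumes disj: "\<And>C D. C \<in> \<C> \<Longrightarrow> D \<in> \<C> \<Longrightarrow> C \<noteq> D \<Longrightarrow> C \<inter> D = {}"
    and invol: "\<And>x. x \<in> \<Union>\<C> \<Longrightarrow> f (f x) = x"
    and block: "\<And>C. C \<in> \<C> \<Longrightarrow> f ` C \<in> \<C>"
    and size: "\<And>C. C \<in> \<C> \<Longrightarrow> p \<le> card C"
    and self: "\<And>C. C \<in> \<C> \<Longrightarrow> f ` C = C \<Longrightarrow> \<exists>T\<subseteq>C. f ` T = T \<and> card T = p"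
  shows "\<exists>S\<subseteq>\<Union>\<C>. f ` S = S \<and> (\<forall>C\<in>\<C>. card (S \<inter> C) = p)"
proof -
  have "\<exists>T\<subseteq>C. card T = p \<and> (f ` C = C \<longrightarrow> f ` T = T)" if "C \<in> \<C>" for C
  proof (cases "f ` C = C")
    case True
    then show ?thesis using self that by blast
  next
    case False
    then show ?thesis using obtain_subset_with_card_n[OF size[OF that]] by metis
  qed
  then obtain U where U: "\<And>C. C \<in> \<C> \<Longrightarrow> U C \<subseteq> C \<and> card (U C) = p \<and> (f ` C = C \<longrightarrow> f ` U C = U C)"
    by metis
  \<comment> \<open>The representative is chosen from the unordered pair, so a block and its image
    automatically receive the same one.\<close>
  define r where "r C = (SOME D. D \<in> {C, f ` C})" for C
  have r: "r C = C \<or> r C = f ` C" for C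
    using someI[of "\<lambda>D. D \<in> {C, f ` C}" C] unfolding r_def by auto
  have ff: "f ` f ` X = X" if "X \<subseteq> C" "C \<in> \<C>" for X C
    using that invol by (force simp: image_image)
  have r_swap: "r (f ` C) = r C" if "C \<in> \<C>" for C
  proof -
    have "{f ` C, f ` f ` C} = {C, f ` C}" using ff[OF subset_refl that] by auto
    then show ?thesis unfolding r_def by simp
  qed
  \<comment> \<open>The representative keeps its own subset, and its partner gets the image of that
    subset.\<close>
  define T where "T C = (if r C = C then U C else f ` U (f ` C))" for C
  have T_sub: "T C \<subseteq> C" if "C \<in> \<C>" for C
    using U[OF that] U[OF block[OF that]] ff[OF subset_refl that]
      image_mono[of "U (f ` C)" "f ` C" f] unfolding T_def by (simp split: if_split)
  have T_card: "card (T C) = p" if "C \<in> \<C>" for C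
  proof -
    have "inj_on f (U (f ` C))"
      by (rule inj_on_inverseI[of _ f]) (use U[OF block[OF that]] invol block[OF that] in blast)
    then show ?thesis using U[OF that] U[OF block[OF that]] unfolding T_def
      by (simp add: card_image)
  qed
  have T_f: "T (f ` C) = f ` T C" if "C \<in> \<C>" for C
  proof (cases "f ` C = C")
    case True
    then show ?thesis using r[of C] U[OF that] unfolding T_def by presburger
  next
    case False
    have ffC: "f ` f ` C = C" and ffU: "f ` f ` U (f ` C) = U (f ` C)"
      using ff[OF subset_refl that] ff[OF _ block[OF that]] U[OF block[OF that]] by blast+
    show ?thesis
    proof (cases "r C = C")
      case True
      then have "r (f ` C) \<noteq> f ` C" using False r_swap[OF that] by metis
      then show ?thesis using True ffC unfolding T_def by presburger
    next
      case no: False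
      then have "r (f ` C) = f ` C" using r[of C] r_swap[OF that] by metis
      then show ?thesis using no ffU unfolding T_def by presburger
    qed
  qed
  define S where "S = \<Union>(T ` \<C>)"
  have "S \<inter> C = T C" if "C \<in> \<C>" for C
  proof
    show "T C \<subseteq> S \<inter> C" using T_sub that unfolding S_def by blast
    show "S \<inter> C \<subseteq> T C"
    proof
      fix x assume "x \<in> S \<inter> C"
      then obtain D where D: "D \<in> \<C>" "x \<in> T D" "x \<in> C" unfolding S_def by blast
      then have "D = C" using disj[OF D(1) that] T_sub by blast
      then show "x \<in> T C" using D by simp
    qed
  qed
  moreover have "f ` S \<subseteq> S"
    using T_f block unfolding S_def by fastforce
  moreover have "S \<subseteq> f ` S"
  proof
    fix x assume x: "x \<in> S"
    then have "f (f x) = x" using T_sub invol unfolding S_def by blast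
    then show "x \<in> f ` S" using \<open>f ` S \<subseteq> S\<close> x by (metis imageI subsetD)
  qed
  moreover have "S \<subseteq> \<Union>\<C>" using T_sub unfolding S_def by blast
  ultimately show ?thesis using T_card by (intro exI[of _ S]) auto
qed

section \<open>Regular subgroups\<close>

text \<open>The neighbours of v in H are the u with \<open>u v^-1\<close> in S, so right translation
  by \<open>v^-1\<close> matches them with the part of S in the coset \<open>H v^-1\<close>; v runs
  through the complement of H exactly when \<open>v^-1\<close> does. Disjointness from H says that H
  has no inner edges, and it also keeps the identity out of S.\<close>

lemma (in group) regular_subgroup_iff:
  assumes H: "subgroup H G" and "H \<noteq> carrier G"
  shows "group_zero_regular_set G k H \<longleftrightarrow>
    (\<exists>S\<subseteq>carrier G. (\<lambda>s. inv s) ` S = S \<and> S \<inter> H = {} \<and>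
      (\<forall>x\<in>carrier G - H. card (S \<inter> (H #> x)) = k))" (is "_ \<longleftrightarrow> (\<exists>S\<subseteq>_. ?R S)")
proof -
  note Hc = subgroup.mem_carrier[OF H]
  \<comment> \<open>An edge is an unordered pair, so either quotient could witness it;
    inverse-closure makes the two conditions equivalent.\<close>
  have edge: "{v, u} \<in> cayley_edges G S \<longleftrightarrow> u \<otimes> inv v \<in> S"
    if "(\<lambda>s. inv s) ` S = S" "u \<in> carrier G" "v \<in> carrier G" for S u v
  proof -
    have "v \<otimes> inv u = inv (u \<otimes> inv v)" using that by (simp add: inv_mult_group)
    then have "v \<otimes> inv u \<in> S \<Longrightarrow> u \<otimes> inv v \<in> S"
      using that by (metis imageI inv_inv inv_closed m_closed)
    then show ?thesis using that(2,3) unfolding cayley_edges_def by (auto simp: doubleton_eq_iff)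
  qed
  have card_eq: "card {u \<in> H. {v, u} \<in> cayley_edges G S} = card (S \<inter> (H #> inv v))"
    if "(\<lambda>s. inv s) ` S = S" "v \<in> carrier G" for S v
  proof (rule bij_betw_same_card[of "\<lambda>u. u \<otimes> inv v"])
    have "{u \<in> H. {v, u} \<in> cayley_edges G S} = {u \<in> H. u \<otimes> inv v \<in> S}"
      using edge[OF that(1) _ that(2)] Hc by blast
    then show "bij_betw (\<lambda>u. u \<otimes> inv v) {u \<in> H. {v, u} \<in> cayley_edges G S} (S \<inter> (H #> inv v))"
      using that(2) Hc by (auto simp: bij_betw_def inj_on_def r_coset_def)
  qed
  have equiv: "zero_regular_set (carrier G) (cayley_edges G S) k H \<longleftrightarrow> ?R S"
    if inv: "(\<lambda>s. inv s) ` S = S" for S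
  proof -
    have "(\<forall>v\<in>H. \<not> (\<exists>u\<in>H. {v, u} \<in> cayley_edges G S)) \<longleftrightarrow> S \<inter> H = {}" (is "?L \<longleftrightarrow> _")
    proof
      assume ?L
      then have "\<forall>u\<in>H. u \<otimes> inv \<one> \<notin> S"
        using edge[OF inv] Hc subgroup.one_closed[OF H] by blast
      then show "S \<inter> H = {}" using Hc by auto
    next
      assume "S \<inter> H = {}"
      then show ?L using edge[OF inv] Hc H
        by (metis IntI empty_iff subgroup.m_closed subgroup.m_inv_closed)
    qed
    moreover have "(\<forall>v\<in>carrier G - H. card (S \<inter> (H #> inv v)) = k) \<longleftrightarrow>
        (\<forall>x\<in>carrier G - H. card (S \<inter> (H #> x)) = k)"
      by (metis DiffD1 DiffD2 DiffI H inv_closed inv_inv subgroup.m_inv_closed)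
    moreover have "H \<noteq> {}" "H \<subset> carrier G"
      using assms(2) subgroup.one_closed[OF H] subgroup.subset[OF H] by blast+
    moreover have "(\<forall>v\<in>carrier G - H. card {u \<in> H. {v, u} \<in> cayley_edges G S} = k) \<longleftrightarrow>
        (\<forall>v\<in>carrier G - H. card (S \<inter> (H #> inv v)) = k)"
      by (rule ball_cong) (simp_all add: card_eq[OF inv])
    ultimately show ?thesis
      using inv unfolding zero_regular_set_def by (simp only: simp_thms)
  qed
  have one: "S \<subseteq> carrier G - {\<one>}" if "S \<subseteq> carrier G" "?R S" for S
    using that subgroup.one_closed[OF H] by blast
  show ?thesis
  proof
    assume "group_zero_regular_set G k H"
    then obtain S where S: "S \<subseteq> carrier G - {\<one>}" "(\<lambda>s. inv s) ` S = S"
      "zero_regular_set (carrier G) (cayley_edges G S) k H"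
      unfolding group_zero_regular_set_def by (elim exE conjE)
    have "?R S" using equiv[OF S(2)] S(3) by (rule iffD1)
    then show "\<exists>S\<subseteq>carrier G. ?R S" using S(1) by (intro exI[of _ S] conjI) blast+
  next
    assume "\<exists>S\<subseteq>carrier G. ?R S"
    then obtain S where S: "S \<subseteq> carrier G" "?R S" by blast
    then have inv: "(\<lambda>s. inv s) ` S = S" by (elim conjE)
    have "zero_regular_set (carrier G) (cayley_edges G S) k H"
      using equiv[OF inv] S(2) by (rule iffD2)
    then show "group_zero_regular_set G k H"
      unfolding group_zero_regular_set_def using one[OF S] inv by (intro exI[of _ S] conjI)
  qed
qed

section \<open>The rotations and flips of a quaternion group\<close>

text \<open>Only the relations, which hold in every quotient of the quaternion group as well. They
  suffice for the multiplication table; what depends on the exact order is left to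
  \<open>quaternion_group\<close>.\<close>

locale quaternion_relations = group +
  fixes a b :: 'a and n :: nat
  assumes a_closed [simp, intro]: "a \<in> carrier G"
    and b_closed [simp, intro]: "b \<in> carrier G"
    and a_pow: "a [^] (2 * int n) = \<one>"
    and b_b: "b \<otimes> b = a [^] int n"
    and b_a: "b \<otimes> a = inv a \<otimes> b"
begin

definition rot :: "int \<Rightarrow> 'a" where "rot i = a [^] i"

definition flip :: "int \<Rightarrow> 'a" where "flip i = a [^] i \<otimes> b"

lemma rot_closed [simp, intro]: "rot i \<in> carrier G"
  and flip_closed [simp, intro]: "flip i \<in> carrier G"
  by (simp_all add: rot_def flip_def)

lemma rot_0: "rot 0 = \<one>"
  by (simp add: rot_def)

lemma rot_rot: "rot i \<otimes> rot j = rot (i + j)"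
  by (simp add: rot_def int_pow_mult)

lemma rot_flip: "rot i \<otimes> flip j = flip (i + j)"
  by (simp add: rot_def flip_def int_pow_mult m_assoc)

lemma inv_rot: "inv (rot i) = rot (- i)"
  by (simp add: rot_def int_pow_neg)

lemma b_rot: "b \<otimes> rot i = rot (- i) \<otimes> b"
proof -
  have nat: "b \<otimes> rot (int m) = rot (- int m) \<otimes> b" for m
  proof (induction m)
    case 0
    then show ?case by (simp add: rot_0)
  next
    case (Suc m)
    have "b \<otimes> rot (int (Suc m)) = (b \<otimes> rot (int m)) \<otimes> rot 1"
      by (simp add: m_assoc rot_rot add.commute)
    also have "\<dots> = rot (- int m) \<otimes> (b \<otimes> a)"
      using Suc by (simp add: m_assoc rot_def)
    also have "\<dots> = rot (- int m) \<otimes> rot (- 1) \<otimes> b"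
      by (simp add: b_a m_assoc rot_def int_pow_neg)
    finally show ?case by (simp add: rot_rot algebra_simps)
  qed
  show ?thesis
  proof (cases "i \<ge> 0")
    case True
    then show ?thesis using nat[of "nat i"] by simp
  next
    case False
    \<comment> \<open>A negative exponent reduces to the positive one \<open>- i\<close>: the known
      relation is inserted between \<open>rot (- i)\<close> and \<open>rot i\<close>.\<close>
    then have "rot (- i) \<otimes> b = rot (- i) \<otimes> (b \<otimes> rot (- i)) \<otimes> rot i"
      by (simp add: m_assoc rot_rot rot_0)
    also have "\<dots> = rot (- i) \<otimes> (rot i \<otimes> b) \<otimes> rot i"
      using nat[of "nat (- i)"] False by simp
    also have "\<dots> = b \<otimes> rot i"
      by (simp add: m_assoc[symmetric] rot_rot rot_0)
    finally show ?thesis by simp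
  qed
qed

lemma flip_rot: "flip i \<otimes> rot j = flip (i - j)"
proof -
  have "flip i \<otimes> rot j = rot i \<otimes> (b \<otimes> rot j)"
    by (simp add: flip_def rot_def m_assoc)
  also have "\<dots> = (rot i \<otimes> rot (- j)) \<otimes> b"
    unfolding b_rot by (simp add: m_assoc)
  finally show ?thesis by (simp add: rot_rot) (simp add: rot_def flip_def)
qed

lemma flip_flip: "flip i \<otimes> flip j = rot (i - j + int n)"
proof -
  have "flip i \<otimes> flip j = (flip i \<otimes> rot j) \<otimes> b"
    by (simp add: flip_def rot_def m_assoc)
  also have "\<dots> = rot (i - j) \<otimes> (b \<otimes> b)"
    unfolding flip_rot by (simp add: flip_def rot_def m_assoc)
  also have "\<dots> = rot (i - j) \<otimes> rot (int n)"
    by (simp add: b_b rot_def)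
  finally show ?thesis by (simp add: rot_rot)
qed

lemma rot_2n: "rot (2 * int n) = \<one>"
  using a_pow by (simp add: rot_def)

lemma inv_flip: "inv (flip i) = flip (i + int n)"
  by (rule inv_equality) (simp_all add: flip_flip rot_2n)

lemma generate_a_b: "generate G {a, b} \<subseteq> range rot \<union> range flip"
proof
  have a: "a = rot 1" and b: "b = flip 0" by (simp_all add: rot_def flip_def)
  fix x assume "x \<in> generate G {a, b}"
  then show "x \<in> range rot \<union> range flip"
  proof (induction rule: generate.induct)
    case one
    then show ?case using rot_0 by (metis UnI1 rangeI)
  next
    case (incl h)
    then show ?case using a b by auto
  next
    case (inv h)
    then have "inv h = rot (- 1) \<or> inv h = flip (0 + int n)"
      using inv_rot[of 1] inv_flip[of 0] unfolding a[symmetric] b[symmetric] by blast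
    then show ?case by blast
  next
    case (eng h1 h2)
    then show ?case by (auto simp: rot_rot rot_flip flip_rot flip_flip)
  qed
qed

end

section \<open>Exponents modulo 2n and the cosets of \<open><a^t>\<close>\<close>

locale quaternion_group = quaternion_relations +
  assumes n_pos: "0 < n"
    and rot_one_iff: "rot i = \<one> \<longleftrightarrow> 2 * int n dvd i"
    and b_not_rot: "b \<noteq> rot i"
    and carrier_eq: "carrier G = range rot \<union> range flip"
begin

lemma rot_eq_iff: "rot i = rot j \<longleftrightarrow> 2 * int n dvd i - j"
proof -
  have "rot i = rot j \<longleftrightarrow> rot i \<otimes> inv (rot j) = \<one>"
    by (metis inv_closed inv_equality inv_inv r_inv rot_closed)
  then show ?thesis by (simp add: inv_rot rot_rot rot_one_iff)
qed

lemma flip_eq_iff: "flip i = flip j \<longleftrightarrow> 2 * int n dvd i - j"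
  unfolding rot_eq_iff[symmetric] by (simp add: flip_def rot_def)

lemma rot_neq_flip [simp]: "rot i \<noteq> flip j" "flip j \<noteq> rot i"
proof -
  show "rot i \<noteq> flip j"
  proof
    assume "rot i = flip j"
    then have "rot (- j) \<otimes> rot i = rot (- j) \<otimes> flip j" by simp
    then show False using b_not_rot[of "i - j"] by (simp add: rot_rot rot_flip) (simp add: flip_def)
  qed
  then show "flip j \<noteq> rot i" by metis
qed

lemma inv_rot_eq_iff: "inv (rot j) = rot j \<longleftrightarrow> int n dvd j"
proof -
  have "- j - j = - (2 * j)" by simp
  then show ?thesis by (simp only: inv_rot rot_eq_iff dvd_minus_iff) simp
qed

lemma inv_flip_neq: "inv (flip j) \<noteq> flip j"
  using n_pos zdvd_not_zless[of "int n" "2 * int n"] by (simp add: inv_flip flip_eq_iff)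

text \<open>These blocks are the right cosets of \<open><a^t>\<close> through \<open>a^i\<close>
  and, for \<open>flips\<close>, through \<open>a^i b\<close>. Describing them by residues modulo t
  turns products, inverses and translates into arithmetic of indices.\<close>

definition rots :: "nat \<Rightarrow> int \<Rightarrow> 'a set" where
  "rots t i = rot ` {j. int t dvd j - i}"

definition flips :: "nat \<Rightarrow> int \<Rightarrow> 'a set" where
  "flips t i = flip ` {j. int t dvd j - i}"

lemma rots_closed: "rots t i \<subseteq> carrier G" and flips_closed: "flips t i \<subseteq> carrier G"
  by (auto simp: rots_def flips_def)

lemma rot_in_rots: "t dvd 2 * n \<Longrightarrow> rot j \<in> rots t i \<longleftrightarrow> int t dvd j - i"
  and flip_in_flips: "t dvd 2 * n \<Longrightarrow> flip j \<in> flips t i \<longleftrightarrow> int t dvd j - i"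
proof -
  assume "t dvd 2 * n"
  then have t: "int t dvd 2 * int n" by (metis int_dvd_int_iff of_nat_mult of_nat_numeral)
  have "int t dvd j - i" if "2 * int n dvd j - l" "int t dvd l - i" for l
    using dvd_add[OF dvd_trans[OF t that(1)] that(2)] by simp
  then show "rot j \<in> rots t i \<longleftrightarrow> int t dvd j - i" "flip j \<in> flips t i \<longleftrightarrow> int t dvd j - i"
    by (auto simp: rots_def flips_def rot_eq_iff flip_eq_iff)
qed

lemma rot_notin_flips [simp]: "rot j \<notin> flips t i" and flip_notin_rots [simp]: "flip j \<notin> rots t i"
  by (auto simp: rots_def flips_def)

lemma rots_Int_flips [simp]: "rots t i \<inter> flips t' j = {}"
  by (auto simp: rots_def flips_def)

lemma rots_cong: "int t dvd i - j \<Longrightarrow> rots t i = rots t j"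
  and flips_cong: "int t dvd i - j \<Longrightarrow> flips t i = flips t j"
proof -
  assume t: "int t dvd i - j"
  have "int t dvd l - i \<longleftrightarrow> int t dvd l - j" for l
    using dvd_add_right_iff[OF t, of "l - i"] by simp
  then show "rots t i = rots t j" "flips t i = flips t j"
    by (simp_all add: rots_def flips_def)
qed

lemma card_rots: "t dvd 2 * n \<Longrightarrow> card (rots t i) = 2 * n div t"
  and card_flips: "t dvd 2 * n \<Longrightarrow> card (flips t i) = 2 * n div t"
proof -
  assume "t dvd 2 * n"
  then obtain m where m: "2 * n = t * m" by blast
  then have pos: "0 < t" "0 < m" using n_pos by (metis gr0I mult_is_0 neq0_conv zero_neq_numeral)+
  have m': "2 * int n = int t * int m" using m by (metis of_nat_mult of_nat_numeral)
  have inj: "k = k'" if "k < m" "k' < m" "2 * int n dvd (i + int t * int k) - (i + int t * int k')" for k k'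
  proof -
    have "(i + int t * int k) - (i + int t * int k') = int t * (int k - int k')"
      by (simp add: algebra_simps)
    then have "int m dvd int k - int k'" using that(3) pos unfolding m' by simp
    then have "int k mod int m = int k' mod int m" by (simp add: mod_eq_dvd_iff)
    then show ?thesis using that by simp
  qed
  have surj: "\<exists>k<m. 2 * int n dvd j - (i + int t * int k)" if j: "int t dvd j - i" for j
  proof -
    obtain l where l: "j - i = int t * l" using j by blast
    \<comment> \<open>Reducing l modulo m changes the exponent by a multiple of t m = 2n, so the
      exponents i, i + t, ..., i + (m - 1) t represent the whole block.\<close>
    define k where "k = nat (l mod int m)"
    have k: "int k = l mod int m" "k < m" using pos by (simp_all add: k_def nat_less_iff)
    have "int m dvd l - int k" unfolding k by (simp add: dvd_minus_mod)
    then have "2 * int n dvd int t * (l - int k)" unfolding m' by simp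
    moreover have "int t * (l - int k) = j - (i + int t * int k)" using l by (simp add: algebra_simps)
    ultimately show ?thesis using k by metis
  qed
  have "bij_betw (\<lambda>k. rot (i + int t * int k)) {..<m} (rots t i)"
    unfolding bij_betw_def inj_on_def
    using inj surj by (auto simp: rots_def rot_eq_iff image_iff) (metis rot_eq_iff lessThan_iff)+
  moreover have "bij_betw (\<lambda>k. flip (i + int t * int k)) {..<m} (flips t i)"
    unfolding bij_betw_def inj_on_def
    using inj surj by (auto simp: flips_def flip_eq_iff image_iff) (metis flip_eq_iff lessThan_iff)+
  ultimately show "card (rots t i) = 2 * n div t" "card (flips t i) = 2 * n div t"
    using m pos by (simp_all add: bij_betw_same_card[symmetric])
qed

lemma finite_rots: "t dvd 2 * n \<Longrightarrow> finite (rots t i)"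
  and finite_flips: "t dvd 2 * n \<Longrightarrow> finite (flips t i)"
proof -
  assume t: "t dvd 2 * n"
  \<comment> \<open>An infinite set has \<open>card\<close> 0, so a nonzero cardinality certifies
    finiteness.\<close>
  then have "2 * n div t \<noteq> 0" using n_pos by (simp add: dvd_div_eq_0_iff)
  then show "finite (rots t i)" "finite (flips t i)"
    using card_rots[OF t] card_flips[OF t] by (metis card.infinite)+
qed

lemma inv_rots: "(\<lambda>x. inv x) ` rots t i = rots t (- i)"
proof -
  have "inv x \<in> rots t (- i)" if x: "x \<in> rots t i" for x i
  proof -
    obtain j where j: "x = rot j" "int t dvd j - i" using x by (auto simp: rots_def)
    have "int t dvd - j - (- i)" using j(2) dvd_minus_iff[of "int t" "j - i"] by simp
    then show ?thesis using j(1) by (auto simp: rots_def inv_rot)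
  qed
  then have 1: "(\<lambda>x. inv x) ` rots t i \<subseteq> rots t (- i)" for i by blast
  have "rots t (- i) = (\<lambda>x. inv x) ` (\<lambda>x. inv x) ` rots t (- i)"
    using rots_closed[of t "- i"] by (force simp: image_image)
  then have "rots t (- i) \<subseteq> (\<lambda>x. inv x) ` rots t i"
    using 1[of "- i"] by (metis image_mono minus_minus)
  then show ?thesis using 1 by blast
qed

lemma inv_flips: "(\<lambda>x. inv x) ` flips t i = flips t (i + int n)"
proof
  show "(\<lambda>x. inv x) ` flips t i \<subseteq> flips t (i + int n)"
    by (auto simp: flips_def inv_flip)
  show "flips t (i + int n) \<subseteq> (\<lambda>x. inv x) ` flips t i"
  proof
    fix x assume "x \<in> flips t (i + int n)"
    then obtain j where j: "x = flip j" "int t dvd j - (i + int n)" by (auto simp: flips_def)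
    have "x = inv (flip (j - int n))" using j(1) by (simp add: inv_flip)
    moreover have "int t dvd (j - int n) - i" using j(2) by (simp add: algebra_simps)
    ultimately show "x \<in> (\<lambda>x. inv x) ` flips t i" by (auto simp: flips_def)
  qed
qed

lemma rots_coset: "rots t i #> rot l = rots t (i + l)" "rots t i #> flip l = flips t (i + l)"
proof -
  have surj: "\<exists>j. int t dvd j - i \<and> m = j + l" if "int t dvd m - (i + l)" for m
    using that by (intro exI[of _ "m - l"]) (simp add: algebra_simps)
  have "int t dvd j + l - (i + l)" if "int t dvd j - i" for j using that by simp
  then show "rots t i #> rot l = rots t (i + l)" "rots t i #> flip l = flips t (i + l)"
    unfolding rots_def flips_def r_coset_def
    using surj by (auto simp: rot_rot rot_flip)
qed

lemma flips_coset: "flips t i #> rot l = flips t (i - l)" "flips t i #> flip l = rots t (i - l + int n)"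
proof -
  have surj: "\<exists>j. int t dvd j - i \<and> m = j - l + c" if "int t dvd m - (i - l + c)" for m c
    using that by (intro exI[of _ "m + l - c"]) (simp add: algebra_simps)
  have "int t dvd j - l - (i - l)" "int t dvd j - l + c - (i - l + c)" if "int t dvd j - i" for j c
    using that by simp_all
  then show "flips t i #> rot l = flips t (i - l)" "flips t i #> flip l = rots t (i - l + int n)"
    unfolding rots_def flips_def r_coset_def
    using surj[of _ 0] surj[of _ "int n"] by (auto simp: flip_rot flip_flip)
qed

end

section \<open>Sufficient and necessary conditions read off from cosets\<close>

text \<open>S may meet H here: nontrivial cosets are disjoint from H, so the inverse-closed part of
  S inside H can be discarded without changing any count. This permits a selection that treats all
  flip blocks alike, including one inside H.\<close>

lemma (in group) regular_subgroupI:
  assumes H: "subgroup H G" "H \<noteq> carrier G"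
    and S: "S \<subseteq> carrier G" "(\<lambda>s. inv s) ` S = S"
    and card: "\<And>x. x \<in> carrier G \<Longrightarrow> x \<notin> H \<Longrightarrow> card (S \<inter> (H #> x)) = k"
  shows "group_zero_regular_set G k H"
proof -
  note Hc = subgroup.mem_carrier[OF H(1)]
  have inv: "inv x \<in> S - H" if "x \<in> S - H" for x
  proof -
    have "inv x \<in> S" using S(2) that by blast
    moreover have "inv x \<notin> H"
      using that S(1) subgroup.m_inv_closed[OF H(1), of "inv x"] by auto
    ultimately show ?thesis by blast
  qed
  have "x \<in> (\<lambda>s. inv s) ` (S - H)" if "x \<in> S - H" for x
    using inv[OF that] that S(1) inv_inv[of x] by (intro image_eqI[of _ _ "inv x"]) auto
  then have "(\<lambda>s. inv s) ` (S - H) = S - H" using inv by blast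
  moreover have "(S - H) \<inter> (H #> x) = S \<inter> (H #> x)" if x: "x \<in> carrier G" "x \<notin> H" for x
  proof -
    have "h \<otimes> x \<notin> H" if h: "h \<in> H" for h
    proof
      assume "h \<otimes> x \<in> H"
      then have "inv h \<otimes> (h \<otimes> x) \<in> H"
        using h H(1) by (simp add: subgroup.m_closed subgroup.m_inv_closed)
      then show False using x h Hc by (simp add: inv_solve_left m_assoc[symmetric])
    qed
    then show ?thesis unfolding r_coset_def by blast
  qed
  ultimately show ?thesis
    unfolding regular_subgroup_iff[OF H] using S(1) card by (intro exI[of _ "S - H"]) auto
qed

lemma (in group) regular_self_inverse_coset_even:
  assumes H: "subgroup H G" "H \<noteq> carrier G"
    and "group_zero_regular_set G k H"
    and x: "x \<in> carrier G" "x \<notin> H"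
    and coset: "\<And>y. y \<in> H #> x \<Longrightarrow> inv y \<in> H #> x \<and> inv y \<noteq> y"
  shows "even k"
proof -
  obtain S where S: "S \<subseteq> carrier G" "(\<lambda>s. inv s) ` S = S" "card (S \<inter> (H #> x)) = k"
    using assms(3) x unfolding regular_subgroup_iff[OF H] by blast
  \<comment> \<open>The group may be infinite here; an infinite intersection has \<open>card\<close>
    0, so then k = 0 is even.\<close>
  show ?thesis
  proof (cases "finite (S \<inter> (H #> x))")
    case True
    then have "even (card (S \<inter> (H #> x)))"
    proof (rule involution_even_card)
      fix y assume y: "y \<in> S \<inter> (H #> x)"
      then have "inv y \<in> S" using S(2) by blast
      then show "inv y \<in> S \<inter> (H #> x) \<and> inv (inv y) = y \<and> inv y \<noteq> y"
        using y coset[of y] S(1) by auto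
    qed
    then show ?thesis using S(3) by simp
  qed (use S(3) in simp)
qed

section \<open>Subgroups of a quaternion group\<close>

context quaternion_group
begin

lemma rot_pow: "rot i [^] j = rot (i * j)" for j :: int
  by (simp add: rot_def int_pow_pow)

lemma rot_dvd_mem:
  assumes "subgroup H G" "rot i \<in> H" "i dvd j"
  shows "rot j \<in> H"
proof -
  obtain l where "j = i * l" using assms(3) by blast
  then show ?thesis using subgroup_int_pow_closed[OF assms(1,2), of l] by (simp add: rot_pow)
qed

lemma subgroup_rots: "subgroup (rots t 0) G"
proof (rule subgroupI)
  show "rots t 0 \<noteq> {}" by (auto simp: rots_def)
qed (auto simp: rots_def inv_rot rot_rot)

text \<open>Every flip squares to \<open>a^n\<close>, so closure needs \<open>a^n\<close> in
  \<open><a^t>\<close>; this is where t dividing n enters.\<close>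

lemma subgroup_rots_flips:
  assumes "t dvd n"
  shows "subgroup (rots t 0 \<union> flips t s) G"
proof (rule subgroupI)
  have t: "int t dvd int n" using assms by simp
  show "rots t 0 \<union> flips t s \<subseteq> carrier G" using rots_closed flips_closed by blast
  show "rots t 0 \<union> flips t s \<noteq> {}" by (auto simp: rots_def)
  fix x assume x: "x \<in> rots t 0 \<union> flips t s"
  have inv_f: "int t dvd i + int n - s" if "int t dvd i - s" for i
    using dvd_add[OF that t] by (simp add: algebra_simps)
  then show "inv x \<in> rots t 0 \<union> flips t s"
    using x by (auto simp: rots_def flips_def inv_rot inv_flip)
  fix y assume y: "y \<in> rots t 0 \<union> flips t s"
  have ff: "int t dvd i - j + int n" if "int t dvd i - s" "int t dvd j - s" for i j
    using dvd_add[OF dvd_diff[OF that] t] by simp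
  have rf: "int t dvd i + j - s" if "int t dvd i" "int t dvd j - s" for i j
    using dvd_add[OF that] by (simp add: algebra_simps)
  have fr: "int t dvd i - j - s" if "int t dvd i - s" "int t dvd j" for i j
    using dvd_diff[OF that] by (simp add: algebra_simps)
  show "x \<otimes> y \<in> rots t 0 \<union> flips t s"
    using x y ff rf fr
    by (auto simp: rots_def flips_def rot_rot rot_flip flip_rot flip_flip)
qed

lemma subgroup_cases:
  assumes H: "subgroup H G"
  obtains (rots) t where "t dvd 2 * n" "H = rots t 0"
  | (rots_flips) t s where "t dvd n" "s < t" "H = rots t 0 \<union> flips t (int s)"
proof -
  \<comment> \<open>Division with remainder by this least exponent, which exists because 2n
    qualifies, shows that the rotations in H are exactly the powers of \<open>a^t\<close>.\<close>
  define t where "t = (LEAST t. 0 < t \<and> rot (int t) \<in> H)"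
  have "0 < 2 * n \<and> rot (int (2 * n)) \<in> H"
    using n_pos rot_2n subgroup.one_closed[OF H] by simp
  then have t: "0 < t" "rot (int t) \<in> H"
    using LeastI[of "\<lambda>t. 0 < t \<and> rot (int t) \<in> H"] unfolding t_def by blast+
  have least: "t \<le> u" if "0 < u" "rot (int u) \<in> H" for u
    unfolding t_def using that by (simp add: Least_le)
  have mem: "rot i \<in> H \<longleftrightarrow> int t dvd i" for i
  proof
    assume "rot i \<in> H"
    moreover have "rot (- (int t * (i div int t))) \<in> H"
      by (rule rot_dvd_mem[OF H t(2)]) simp
    ultimately have "rot (i + - (int t * (i div int t))) \<in> H"
      unfolding rot_rot[symmetric] by (rule subgroup.m_closed[OF H])
    then have r: "rot (i mod int t) \<in> H" by (simp add: minus_mult_div_eq_mod)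
    have "\<not> 0 < i mod int t"
    proof
      assume pos: "0 < i mod int t"
      then have "t \<le> nat (i mod int t)" using least[of "nat (i mod int t)"] r by simp
      moreover have "i mod int t < int t" using t by simp
      ultimately show False using pos by linarith
    qed
    moreover have "0 \<le> i mod int t" using t by simp
    ultimately show "int t dvd i" by (simp add: dvd_eq_mod_eq_0)
  next
    assume "int t dvd i"
    then show "rot i \<in> H" by (rule rot_dvd_mem[OF H t(2)])
  qed
  have "int t dvd int (2 * n)"
    using mem[of "2 * int n"] rot_2n subgroup.one_closed[OF H] by simp
  then have t2n: "t dvd 2 * n" by (simp only: int_dvd_int_iff)
  have H_sub: "H \<subseteq> range rot \<union> range flip" using subgroup.subset[OF H] carrier_eq by simp
  show thesis
  proof (cases "\<exists>l. flip l \<in> H")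
    case False
    then have "H = rots t 0" using H_sub mem by (auto simp: rots_def)
    then show thesis using t2n rots by blast
  next
    case True
    then obtain l where l: "flip l \<in> H" by blast
    then have "flip l \<otimes> flip l \<in> H" using subgroup.m_closed[OF H] by blast
    \<comment> \<open>The square of a flip is \<open>a^n\<close>. With t dividing n, the product of
      two flips in H forces their indices to agree modulo t, so the flips in H form a single residue
      class.\<close>
    then have tn: "int t dvd int n" unfolding flip_flip mem by simp
    define s where "s = nat (l mod int t)"
    have s: "int s = l mod int t" "s < t" using t by (simp_all add: s_def nat_less_iff)
    have ls: "int t dvd l - int s" unfolding s by (simp add: dvd_minus_mod)
    have "flip m \<in> H \<longleftrightarrow> int t dvd m - int s" for m
    proof
      assume "flip m \<in> H"
      then have "flip m \<otimes> flip l \<in> H" using l subgroup.m_closed[OF H] by blast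
      then have "int t dvd m - l" unfolding flip_flip mem using tn dvd_add_left_iff by blast
      then show "int t dvd m - int s" using dvd_add[OF _ ls] by fastforce
    next
      assume "int t dvd m - int s"
      then have "int t dvd m - l" using dvd_diff[OF _ ls] by fastforce
      then have "rot (m - l) \<otimes> flip l \<in> H" using l subgroup.m_closed[OF H] mem by blast
      then show "flip m \<in> H" by (simp add: rot_flip)
    qed
    then have "H = rots t 0 \<union> flips t (int s)"
      using H_sub mem by (auto simp: rots_def flips_def)
    then show thesis using tn s(2) rots_flips by simp
  qed
qed

lemma generate_rots: "generate G {a [^] (t::nat)} = rots t 0"
proof
  have a: "a [^] t = rot (int t)" by (simp add: rot_def int_pow_int)
  show "generate G {a [^] t} \<subseteq> rots t 0"
    by (rule generate_subgroup_incl[OF _ subgroup_rots]) (simp add: a rots_def)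
  have "subgroup (generate G {a [^] t}) G" by (rule generate_is_subgroup) simp
  moreover have "rot (int t) \<in> generate G {a [^] t}" unfolding a by (simp add: generate.incl)
  ultimately show "rots t 0 \<subseteq> generate G {a [^] t}"
    using rot_dvd_mem by (auto simp: rots_def)
qed

lemma generate_rots_flips:
  assumes "t dvd n"
  shows "generate G {a [^] (t::nat), a [^] (s::nat) \<otimes> b} = rots t 0 \<union> flips t (int s)"
proof
  have a: "a [^] t = rot (int t)" "a [^] s \<otimes> b = flip (int s)"
    by (simp_all add: rot_def flip_def int_pow_int)
  let ?K = "generate G {a [^] t, a [^] s \<otimes> b}"
  show "?K \<subseteq> rots t 0 \<union> flips t (int s)"
    by (rule generate_subgroup_incl[OF _ subgroup_rots_flips[OF assms]])
      (simp add: a rots_def flips_def)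
  have K: "subgroup ?K G" by (rule generate_is_subgroup) simp
  have "rot (int t) \<in> ?K" and f: "flip (int s) \<in> ?K" unfolding a by (simp_all add: generate.incl)
  then have r: "rot i \<in> ?K" if "int t dvd i" for i using rot_dvd_mem[OF K] that by blast
  have "flip i \<in> ?K" if "int t dvd i - int s" for i
    using subgroup.m_closed[OF K r[OF that] f] by (simp add: rot_flip)
  then show "rots t 0 \<union> flips t (int s) \<subseteq> ?K" using r by (auto simp: rots_def flips_def)
qed

section \<open>Connection sets\<close>

text \<open>With 2n = t m, both sides say that m is odd. This translates odd order of
  \<open><a^t>\<close> into \<open>a^n\<close> lying outside it.\<close>

lemma odd_quotient_iff:
  assumes "t dvd 2 * n"
  shows "odd (2 * n div t) \<longleftrightarrow> \<not> t dvd n"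
proof -
  obtain m where m: "2 * n = t * m" using assms by blast
  then have t: "0 < t" using n_pos by (metis gr0I mult_is_0 neq0_conv zero_neq_numeral)
  have "t dvd n \<longleftrightarrow> 2 * t dvd 2 * n" by simp
  also have "\<dots> \<longleftrightarrow> even m" using t unfolding m by (simp add: mult.commute[of 2])
  finally show ?thesis using m t by simp
qed

lemma rots_disjoint: "rots t i \<noteq> rots t j \<Longrightarrow> rots t i \<inter> rots t j = {}"
  and flips_disjoint: "flips t i \<noteq> flips t j \<Longrightarrow> flips t i \<inter> flips t j = {}"
  if "t dvd 2 * n"
proof -
  have *: "int t dvd i - j" if "int t dvd l - i" "int t dvd l - j" for l
    using dvd_diff[OF that(2,1)] by simp
  show "rots t i \<inter> rots t j = {}" if ne: "rots t i \<noteq> rots t j"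
  proof (rule ccontr)
    assume "rots t i \<inter> rots t j \<noteq> {}"
    then obtain l where "rot l \<in> rots t i" "rot l \<in> rots t j" by (auto simp: rots_def)
    then show False using * rots_cong ne rot_in_rots[OF \<open>t dvd 2 * n\<close>] by blast
  qed
  show "flips t i \<inter> flips t j = {}" if ne: "flips t i \<noteq> flips t j"
  proof (rule ccontr)
    assume "flips t i \<inter> flips t j \<noteq> {}"
    then obtain l where "flip l \<in> flips t i" "flip l \<in> flips t j" by (auto simp: flips_def)
    then show False using * flips_cong ne flip_in_flips[OF \<open>t dvd 2 * n\<close>] by blast
  qed
qed

text \<open>Self-inverse means that t divides 2i; as t does not divide i, t is even. If t divides n,
  no index in the block is a multiple of n, so inversion has no fixed point and \<open>par\<close>
  leaves only even p. Otherwise \<open>a^n\<close> lies in the block and is the only fixed point, so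
  every p is available.\<close>

lemma rots_self_inverse_subset:
  assumes t: "t dvd 2 * n" and p: "p \<le> 2 * n div t"
    and par: "odd t \<or> \<not> t dvd n \<or> even p"
    and i: "\<not> int t dvd i" and self: "rots t (- i) = rots t i"
  shows "\<exists>T\<subseteq>rots t i. (\<lambda>x. inv x) ` T = T \<and> card T = p"
proof -
  have t': "int t dvd 2 * int n" using t by (metis int_dvd_int_iff of_nat_mult of_nat_numeral)
  have "rot (- i) \<in> rots t i" unfolding self[symmetric] by (simp add: rots_def)
  then have "int t dvd - (2 * i)" unfolding rot_in_rots[OF t] by simp
  then have ti: "int t dvd 2 * i" by (simp only: dvd_minus_iff)
  have "even t"
  proof (rule ccontr)
    assume "odd t"
    then have "coprime (int t) 2" by simp
    then show False using ti i by (simp add: coprime_dvd_mult_right_iff)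
  qed
  have inv_mem: "inv x \<in> rots t i" if "x \<in> rots t i" for x
    using that self inv_rots[of t i] by blast
  have inv_inv': "inv (inv x) = x" if "x \<in> rots t i" for x
    using that rots_closed by (intro inv_inv) blast
  have not_t: "\<not> int t dvd j" if "rot j \<in> rots t i" for j
    using that i dvd_diff[of "int t" j "j - i"] unfolding rot_in_rots[OF t] by auto
  show ?thesis
  proof (cases "t dvd n")
    case True
    have "inv x \<noteq> x" if x: "x \<in> rots t i" for x
    proof -
      obtain j where j: "x = rot j" using x by (auto simp: rots_def)
      have "\<not> int n dvd j" using not_t[of j] x True j by (meson dvd_trans int_dvd_int_iff)
      then show ?thesis unfolding j inv_rot_eq_iff .
    qed
    moreover have "even p" using par \<open>even t\<close> True by blast
    ultimately show ?thesis
      using involution_even_subset[of "rots t i" "\<lambda>x. inv x" "p div 2"]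
        finite_rots[OF t] card_rots[OF t] p inv_mem inv_inv' by simp
  next
    case False
    obtain m where m: "2 * n = t * m" using t by blast
    obtain u where u: "t = 2 * u" using \<open>even t\<close> by blast
    have "odd m" using odd_quotient_iff[OF t] False m n_pos by (cases "t = 0") auto
    have n: "n = u * m" using m u by simp
    obtain c where c: "i = int u * c" using ti u by auto
    have u0: "u \<noteq> 0" using n n_pos by auto
    have "odd c" using i u0 unfolding c u by (auto elim!: evenE)
    \<comment> \<open>Here n = u m and i = u c with m and c both odd, so n - i = u (m - c) is a
      multiple of 2u = t.\<close>
    then have "2 dvd int m - c" using \<open>odd m\<close> by simp
    then have "int t dvd int n - i" unfolding u c n
      by (metis dvd_mult_cancel_left int_ops(7) mult.commute mult_dvd_mono dvd_refl of_nat_numeral right_diff_distrib)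
    then have z: "rot (int n) \<in> rots t i" unfolding rot_in_rots[OF t] .
    have "inv x \<noteq> x" if x: "x \<in> rots t i" and xz: "x \<noteq> rot (int n)" for x
    proof
      assume eq: "inv x = x"
      obtain j where j: "x = rot j" using x by (auto simp: rots_def)
      then obtain l where l: "j = int n * l" using eq inv_rot_eq_iff by blast
      \<comment> \<open>An even multiple of n as exponent gives the identity, which lies in the
        excluded block \<open>rots t 0\<close>; an odd multiple gives \<open>a^n\<close>.\<close>
      show False
      proof (cases "even l")
        case True
        then have "2 * int n dvd j" unfolding l by (auto elim!: evenE)
        then show False using not_t[of j] x j t' dvd_trans by blast
      next
        case False
        then have "2 dvd l - 1" by simp
        then have "2 * int n dvd int n * (l - 1)" by (simp add: mult.commute[of 2])
        then have "2 * int n dvd j - int n" unfolding l by (simp add: algebra_simps)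
        then show False using xz unfolding j rot_eq_iff by simp
      qed
    qed
    then show ?thesis
      using involution_one_fixed_subset[of "rots t i" "rot (int n)" "\<lambda>x. inv x" p] z
        finite_rots[OF t] card_rots[OF t] p inv_mem inv_inv' inv_rot_eq_iff[of "int n"] by simp
  qed
qed

lemma rots_selection:
  assumes t: "t dvd 2 * n" and p: "p \<le> 2 * n div t"
    and par: "odd t \<or> \<not> t dvd n \<or> even p"
  obtains S where "S \<subseteq> range rot" "(\<lambda>x. inv x) ` S = S"
    "\<And>i. \<not> int t dvd i \<Longrightarrow> card (S \<inter> rots t i) = p"
proof -
  let ?C = "rots t ` {i. \<not> int t dvd i}"
  have "\<exists>S\<subseteq>\<Union>?C. (\<lambda>x. inv x) ` S = S \<and> (\<forall>C\<in>?C. card (S \<inter> C) = p)"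
  proof (rule invariant_selection)
    fix C assume "C \<in> ?C"
    then obtain i where i: "C = rots t i" "\<not> int t dvd i" by blast
    show "(\<lambda>x. inv x) ` C \<in> ?C" unfolding i inv_rots using i by auto
    show "p \<le> card C" using i card_rots[OF t] p by simp
    show "\<exists>T\<subseteq>C. (\<lambda>x. inv x) ` T = T \<and> card T = p" if "(\<lambda>x. inv x) ` C = C"
      using rots_self_inverse_subset[OF t p par i(2)] that unfolding i inv_rots by blast
  next
    fix x assume "x \<in> \<Union>?C"
    then show "inv (inv x) = x" using rots_closed by (intro inv_inv) blast
  next
    fix C D assume "C \<in> ?C" "D \<in> ?C" "C \<noteq> D"
    then show "C \<inter> D = {}" using rots_disjoint[OF t] by blast
  qed
  then obtain S where S: "S \<subseteq> \<Union>?C" "(\<lambda>x. inv x) ` S = S" "\<forall>C\<in>?C. card (S \<inter> C) = p"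
    by blast
  show thesis
  proof (rule that[OF _ S(2)])
    show "S \<subseteq> range rot" using S(1) by (auto simp: rots_def)
  qed (use S(3) in blast)
qed

lemma flips_selection:
  assumes t: "t dvd 2 * n" and q: "q \<le> 2 * n div t"
    and par: "\<not> t dvd n \<or> even q"
  obtains S where "S \<subseteq> range flip" "(\<lambda>x. inv x) ` S = S"
    "\<And>i. card (S \<inter> flips t i) = q"
proof -
  let ?C = "range (flips t)"
  have "\<exists>S\<subseteq>\<Union>?C. (\<lambda>x. inv x) ` S = S \<and> (\<forall>C\<in>?C. card (S \<inter> C) = q)"
  proof (rule invariant_selection)
    fix C assume "C \<in> ?C"
    then obtain i where i: "C = flips t i" by blast
    show "(\<lambda>x. inv x) ` C \<in> ?C" unfolding i inv_flips by simp
    show "q \<le> card C" using i card_flips[OF t] q by simp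
    assume self: "(\<lambda>x. inv x) ` C = C"
    \<comment> \<open>Self-inverse flip blocks occur only if t divides n, and then
      \<open>par\<close> makes q even, as the absence of self-inverse flips requires.\<close>
    have "flip (i + int n) \<in> flips t i"
      using self unfolding i inv_flips by (auto simp: flips_def)
    then have "even q" using par unfolding flip_in_flips[OF t] by simp
    moreover have "inv x \<in> C \<and> inv (inv x) = x \<and> inv x \<noteq> x" if x: "x \<in> C" for x
    proof -
      obtain j where "x = flip j" using x unfolding i flips_def by blast
      then have "inv (inv x) = x" "inv x \<noteq> x" using inv_flip_neq by simp_all
      moreover have "inv x \<in> C" using self x by blast
      ultimately show ?thesis by blast
    qed
    ultimately show "\<exists>T\<subseteq>C. (\<lambda>x. inv x) ` T = T \<and> card T = q"
      using involution_even_subset[of C "\<lambda>x. inv x" "q div 2"]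
        finite_flips[OF t] card_flips[OF t] q i by simp
  next
    fix x assume "x \<in> \<Union>?C"
    then show "inv (inv x) = x" using flips_closed by (intro inv_inv) blast
  next
    fix C D assume "C \<in> ?C" "D \<in> ?C" "C \<noteq> D"
    then show "C \<inter> D = {}" using flips_disjoint[OF t] by blast
  qed
  then obtain S where S: "S \<subseteq> \<Union>?C" "(\<lambda>x. inv x) ` S = S" "\<forall>C\<in>?C. card (S \<inter> C) = q"
    by blast
  show thesis
  proof (rule that[OF _ S(2)])
    show "S \<subseteq> range flip" using S(1) by (auto simp: flips_def)
  qed (use S(3) in blast)
qed

text \<open>Inversion preserves rotations and flips separately, so the two sizes can be prescribed
  independently, each with its own parity condition.\<close>

lemma connection_set:
  assumes t: "t dvd 2 * n" and p: "p \<le> 2 * n div t" and q: "q \<le> 2 * n div t"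
    and "odd t \<or> \<not> t dvd n \<or> even p" and "\<not> t dvd n \<or> even q"
  obtains S where "S \<subseteq> carrier G" "(\<lambda>x. inv x) ` S = S"
    "\<And>i. \<not> int t dvd i \<Longrightarrow> card (S \<inter> rots t i) = p" "\<And>i. card (S \<inter> flips t i) = q"
proof -
  obtain R where R: "R \<subseteq> range rot" "(\<lambda>x. inv x) ` R = R"
    "\<And>i. \<not> int t dvd i \<Longrightarrow> card (R \<inter> rots t i) = p"
    using rots_selection[OF t p assms(4)] by blast
  obtain F where F: "F \<subseteq> range flip" "(\<lambda>x. inv x) ` F = F" "\<And>i. card (F \<inter> flips t i) = q"
    using flips_selection[OF t q assms(5)] by blast
  have "(R \<union> F) \<inter> rots t i = R \<inter> rots t i" "(R \<union> F) \<inter> flips t i = F \<inter> flips t i" for i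
    using R(1) F(1) by (auto simp: rots_def flips_def)
  moreover have "(\<lambda>x. inv x) ` (R \<union> F) = R \<union> F" using R(2) F(2) by (simp add: image_Un)
  moreover have "R \<union> F \<subseteq> carrier G" using R(1) F(1) by auto
  ultimately show thesis using that[of "R \<union> F"] R(3) F(3) by simp
qed

section \<open>Regularity\<close>

lemma regular_rots:
  assumes t: "t dvd 2 * n" and k: "k \<le> card (rots t 0)" and par: "\<not> t dvd n \<or> even k"
  shows "group_zero_regular_set G k (rots t 0)"
proof -
  have k: "k \<le> 2 * n div t" using k card_rots[OF t] by simp
  obtain S where S: "S \<subseteq> carrier G" "(\<lambda>x. inv x) ` S = S"
    "\<And>i. \<not> int t dvd i \<Longrightarrow> card (S \<inter> rots t i) = k" "\<And>i. card (S \<inter> flips t i) = k"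
    using connection_set[OF t k k] par by blast
  have "flip 0 \<in> carrier G - rots t 0" by simp
  then have "rots t 0 \<noteq> carrier G" by blast
  then show ?thesis
  proof (rule regular_subgroupI[OF subgroup_rots _ S(1,2)])
    fix x assume x: "x \<in> carrier G" "x \<notin> rots t 0"
    then consider i where "x = rot i" "\<not> int t dvd i" | i where "x = flip i"
      unfolding carrier_eq using rot_in_rots[OF t, of _ 0] by auto
    then show "card (S \<inter> (rots t 0 #> x)) = k"
      by cases (use S(3,4) in \<open>simp_all add: rots_coset\<close>)
  qed
qed

text \<open>The obstruction is the coset of \<open>b\<close>: inversion shifts flip indices by n, a
  multiple of t, and so maps this block to itself without fixed points.\<close>

lemma not_regular_rots:
  assumes t: "t dvd n" and "group_zero_regular_set G k (rots t 0)"
  shows "even k"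
proof (rule regular_self_inverse_coset_even[OF subgroup_rots _ assms(2)])
  have "flip 0 \<in> carrier G - rots t 0" by simp
  then show "rots t 0 \<noteq> carrier G" by blast
  fix y assume "y \<in> rots t 0 #> flip 0"
  then have y: "y \<in> flips t 0" by (simp add: rots_coset)
  have "flips t (0 + int n) = flips t 0" using t by (intro flips_cong) simp
  then have "inv y \<in> flips t 0" using y inv_flips[of t 0] by blast
  moreover have "inv y \<noteq> y" using y inv_flip_neq by (auto simp: flips_def)
  ultimately show "inv y \<in> rots t 0 #> flip 0 \<and> inv y \<noteq> y" by (simp add: rots_coset)
qed auto

lemma dihedral_coset:
  assumes t: "t dvd n"
  shows "(rots t 0 \<union> flips t s) #> rot i = rots t i \<union> flips t (s - i)"
    and "(rots t 0 \<union> flips t s) #> flip i = rots t (s - i) \<union> flips t i"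
proof -
  have Un: "(A \<union> B) #> x = (A #> x) \<union> (B #> x)" for A B x
    by (auto simp: r_coset_def)
  have "rots t (s - i + int n) = rots t (s - i)" using t by (intro rots_cong) simp
  then show "(rots t 0 \<union> flips t s) #> rot i = rots t i \<union> flips t (s - i)"
    "(rots t 0 \<union> flips t s) #> flip i = rots t (s - i) \<union> flips t i"
    by (auto simp: Un rots_coset flips_coset)
qed

lemma regular_rots_flips:
  assumes t: "t dvd n" and proper: "rots t 0 \<union> flips t s \<noteq> carrier G"
    and k: "k \<le> card (rots t 0 \<union> flips t s)" and par: "odd t \<or> even k"
  shows "group_zero_regular_set G k (rots t 0 \<union> flips t s)"
proof -
  define m where "m = 2 * n div t"
  have t2: "t dvd 2 * n" using t by simp
  have "even m" "0 < m" using odd_quotient_iff[OF t2] t n_pos unfolding m_def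
    by (auto simp: dvd_div_eq_0_iff)
  have k: "k \<le> 2 * m"
    using k t2 by (simp add: card_Un_disjoint finite_rots finite_flips card_rots card_flips m_def)
  \<comment> \<open>Rotations take as much of k as possible under the constraint that k - p is even,
    since t dividing n makes every flip block self-inverse. As m is even, m - 1 is the largest odd
    size available when k is odd and exceeds m.\<close>
  define p where "p = (if k \<le> m then k else if even k then m else m - 1)"
  have p: "p \<le> m" "k - p \<le> m" "p \<le> k" "even (k - p)" "odd t \<or> even p"
  proof -
    \<comment> \<open>An odd k is strictly below the even bound 2m, which is what keeps k - (m - 1)
      within a block of size m.\<close>
    have "Suc k \<le> 2 * m" if "odd k" using that k by (metis Suc_leI dvd_triv_left le_neq_implies_less)
    then show "p \<le> m" "k - p \<le> m" "p \<le> k" "even (k - p)" "odd t \<or> even p"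
      using k par \<open>even m\<close> \<open>0 < m\<close> unfolding p_def by (auto split: if_splits)
  qed
  obtain S where S: "S \<subseteq> carrier G" "(\<lambda>x. inv x) ` S = S"
    "\<And>i. \<not> int t dvd i \<Longrightarrow> card (S \<inter> rots t i) = p" "\<And>i. card (S \<inter> flips t i) = k - p"
    using connection_set[OF t2, of p "k - p"] p unfolding m_def by blast
  have card: "card (S \<inter> (rots t i \<union> flips t j)) = k" if i: "\<not> int t dvd i" for i j
  proof -
    have "card ((S \<inter> rots t i) \<union> (S \<inter> flips t j)) = p + (k - p)"
    proof (subst card_Un_disjoint)
      show "(S \<inter> rots t i) \<inter> (S \<inter> flips t j) = {}" using rots_Int_flips[of t i t j] by blast
    qed (use t2 S(3)[OF i] S(4) in \<open>simp_all add: finite_rots finite_flips\<close>)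
    then show ?thesis using p(3) by (simp add: Int_Un_distrib)
  qed
  show ?thesis
  proof (rule regular_subgroupI[OF subgroup_rots_flips[OF t] proper S(1,2)])
    fix x assume x: "x \<in> carrier G" "x \<notin> rots t 0 \<union> flips t s"
    \<comment> \<open>In both cases the rotation block of the coset differs from
      \<open>rots t 0\<close>, so S has p elements there and k - p in the flip block.\<close>
    then consider i where "x = rot i" "\<not> int t dvd i" | i where "x = flip i" "\<not> int t dvd s - i"
      unfolding carrier_eq using rot_in_rots[OF t2, of _ 0] flip_in_flips[OF t2, of _ s]
      by (auto simp: dvd_diff_commute)
    then show "card (S \<inter> (rots t 0 \<union> flips t s #> x)) = k"
      by cases (use card in \<open>simp_all add: dihedral_coset[OF t]\<close>)
  qed
qed

text \<open>The obstruction is the coset of \<open>a^u\<close> with u = t/2: since u and -u agree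
  modulo t, its rotation block is self-inverse, and its flip block is so because t divides n.
  Rotation indices there are not multiples of t, hence not of n, so inversion fixes nothing.\<close>

lemma not_regular_rots_flips:
  assumes t: "t dvd n" and "even t" and regular: "group_zero_regular_set G k (rots t 0 \<union> flips t s)"
  shows "even k"
proof -
  have t2: "t dvd 2 * n" using t by simp
  obtain u where u: "t = 2 * u" using \<open>even t\<close> by blast
  have "0 < u" using t n_pos u by (cases u) auto
  have not_u: "\<not> int t dvd int u"
    using \<open>0 < u\<close> zdvd_not_zless[of "int u" "int t"] unfolding u by simp
  let ?H = "rots t 0 \<union> flips t s"
  have x: "rot (int u) \<in> carrier G" "rot (int u) \<notin> ?H"
    using not_u rot_in_rots[OF t2, of "int u" 0] by simp_all
  then have "?H \<noteq> carrier G" by blast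
  then show ?thesis
  proof (rule regular_self_inverse_coset_even[OF subgroup_rots_flips[OF t] _ regular x])
    fix y assume "y \<in> ?H #> rot (int u)"
    then have y: "y \<in> rots t (int u) \<or> y \<in> flips t (s - int u)"
      unfolding dihedral_coset[OF t] by blast
    have "rots t (- int u) = rots t (int u)"
      using u dvd_minus_iff[of "int t" "2 * int u"] by (intro rots_cong) simp
    then have r: "y \<in> rots t (int u) \<Longrightarrow> inv y \<in> rots t (int u)"
      using inv_rots[of t "int u"] by blast
    have "flips t (s - int u + int n) = flips t (s - int u)" using t by (intro flips_cong) simp
    then have f: "y \<in> flips t (s - int u) \<Longrightarrow> inv y \<in> flips t (s - int u)"
      using inv_flips[of t "s - int u"] by blast
    have "inv y \<noteq> y" if "y \<in> rots t (int u)"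
    proof -
      from that obtain j where j: "y = rot j" "int t dvd j - int u" by (auto simp: rots_def)
      have "\<not> int t dvd j" using dvd_diff[OF _ j(2), of j] not_u by auto
      then have "\<not> int n dvd j" using t by (meson dvd_trans int_dvd_int_iff)
      then show ?thesis unfolding j inv_rot_eq_iff .
    qed
    moreover have "inv y \<noteq> y" if "y \<in> flips t (s - int u)"
      using that inv_flip_neq by (auto simp: flips_def)
    ultimately show "inv y \<in> ?H #> rot (int u) \<and> inv y \<noteq> y"
      unfolding dihedral_coset[OF t] using y r f by blast
  qed
qed

theorem regular_subgroup_classification:
  assumes H: "subgroup H G" and proper: "H \<noteq> carrier G" and k: "k \<le> card H"
  shows "(even k \<longrightarrow> group_zero_regular_set G k H) \<and>
    (odd k \<longrightarrow>
      (group_zero_regular_set G k H \<longleftrightarrow>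
        (\<exists>t. t dvd 2 * n \<and> odd (2 * n div t) \<and> H = generate G {a [^] t}) \<or>
        (\<exists>t s. t dvd 2 * n \<and> odd t \<and> s \<le> t - 1 \<and>
           H = generate G {a [^] t, a [^] s \<otimes> b})))"
proof -
  have odd_dvd: "t dvd n" if "t dvd 2 * n" "odd t" for t
    using that by (simp add: coprime_dvd_mult_right_iff)
  have even: "group_zero_regular_set G k H" if "even k"
    using H
  proof (cases rule: subgroup_cases)
    case (rots t)
    then show ?thesis using regular_rots k that by simp
  next
    case (rots_flips t s)
    then show ?thesis using regular_rots_flips proper k that by simp
  qed
  have 1: "group_zero_regular_set G k H"
    if "t dvd 2 * n" "odd (2 * n div t)" "H = generate G {a [^] t}" for t :: nat
    using that regular_rots[OF that(1)] k odd_quotient_iff[OF that(1)] unfolding generate_rots by simp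
  have 2: "group_zero_regular_set G k H"
    if "t dvd 2 * n" "odd t" "H = generate G {a [^] t, a [^] s \<otimes> b}" for t s :: nat
    using that regular_rots_flips[OF odd_dvd[OF that(1,2)]] k proper
    unfolding generate_rots_flips[OF odd_dvd[OF that(1,2)]] by simp
  have 3: "(\<exists>t. t dvd 2 * n \<and> odd (2 * n div t) \<and> H = generate G {a [^] t}) \<or>
      (\<exists>t s. t dvd 2 * n \<and> odd t \<and> s \<le> t - 1 \<and> H = generate G {a [^] t, a [^] s \<otimes> b})"
    if "odd k" "group_zero_regular_set G k H"
    using H
  proof (cases rule: subgroup_cases)
    case (rots t)
    then have "odd (2 * n div t)" using not_regular_rots that odd_quotient_iff by blast
    then show ?thesis using rots generate_rots by blast
  next
    case (rots_flips t s)
    \<comment> \<open>As t is odd, hence positive, the truncated difference \<open>t - 1\<close>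
      expresses s < t exactly.\<close>
    then have "odd t" "t dvd 2 * n" "s \<le> t - 1" using not_regular_rots_flips that by auto
    then show ?thesis using rots_flips(3) generate_rots_flips[OF rots_flips(1)] by metis
  qed
  show ?thesis using even 1 2 3 by blast
qed

end

section \<open>The presentation\<close>

text \<open>The relations hold for \<open>a \<mapsto> diag(w, cnj w)\<close> acting on pairs of complex numbers. For
  \<open>w = cis (pi / n)\<close> this shows that \<open>a\<close> has order exactly \<open>2n\<close> and that \<open>b\<close> is no power of \<open>a\<close>.\<close>

fun letter_action :: "complex \<Rightarrow> quat_gen \<times> bool \<Rightarrow> complex \<times> complex \<Rightarrow> complex \<times> complex" where
  "letter_action w (GenA, True) (x, y) = (w * x, cnj w * y)"
| "letter_action w (GenA, False) (x, y) = (cnj w * x, w * y)"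
| "letter_action w (GenB, True) (x, y) = (- y, x)"
| "letter_action w (GenB, False) (x, y) = (y, - x)"

lemma word_action_replicate:
  "foldr (letter_action w) (replicate m (GenA, True)) (x, y) = (w ^ m * x, cnj w ^ m * y)"
  by (induction m) (simp_all add: mult.assoc)

text \<open>Different actions therefore certify different group elements.
  \<open>w * cnj w = 1\<close> makes cancellation valid, and \<open>w ^ n = - 1\<close> makes
  \<open>a^n\<close> and \<open>b^2\<close> both act as negation.\<close>

lemma word_eq_action:
  assumes w: "w * cnj w = 1" "w ^ n = - 1" and "word_eq (quat_relations n) u v"
  shows "foldr (letter_action w) u = foldr (letter_action w) v"
  using assms(3)
proof (induction rule: word_eq.induct)
  case (cancel u g i v)
  have "letter_action w (g, i) (letter_action w (g, \<not> i) q) = q" for q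
    using w(1) by (cases q; cases g; cases i) (simp_all add: mult.assoc[symmetric] mult.commute[of "cnj w"])
  then show ?case by (simp add: fun_eq_iff)
next
  case (relation l r u v)
  have cnj: "cnj w ^ n = - 1" using w(2) by (metis complex_cnj_power complex_cnj_minus complex_cnj_one)
  have w2: "w ^ (2 * n) = 1" "cnj w ^ (2 * n) = 1"
    using w(2) cnj by (simp_all add: mult.commute[of 2] power_mult)
  have "foldr (letter_action w) l q = foldr (letter_action w) r q" for q
    using relation w2 w cnj unfolding quat_relations_def
    by (cases q) (auto simp: word_action_replicate simp del: foldr_replicate)
  then show ?case by (simp add: fun_eq_iff)
qed simp_all

lemma (in group) word_val_replicate:
  "f x \<in> carrier G \<Longrightarrow> word_val G f (replicate m (x, True)) = f x [^] m"
  by (induction m) (simp_all add: nat_pow_Suc2[symmetric] del: nat_pow_Suc)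

lemma generalized_quaternion_group:
  fixes G (structure)
  assumes "generalized_quaternion G a b n" and n: "0 < n"
  shows "quaternion_group G a b n"
proof -
  let ?f = "case_quat_gen a b"
  have range: "range ?f = {a, b}"
    by (auto simp: image_iff split: quat_gen.splits intro: exI[of _ GenA] exI[of _ GenB])
  have "group G" and ab: "a \<in> carrier G" "b \<in> carrier G"
    and gen: "generate G {a, b} = carrier G"
    and word: "\<And>u v. word_val G ?f u = word_val G ?f v \<longleftrightarrow> word_eq (quat_relations n) u v"
    using assms(1) unfolding generalized_quaternion_def has_presentation_def range by auto
  then interpret group G by simp
  have rel: "word_val G ?f l = word_val G ?f r" if "(l, r) \<in> quat_relations n" for l r
    unfolding word using word_eq.relation[OF that, of "[]" "[]"] by simp
  have val: "word_val G ?f (replicate m (GenA, True)) = a [^] m" for m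
    using word_val_replicate[of ?f GenA m] ab by simp
  interpret quaternion_relations G a b n
  proof unfold_locales
    show "a [^] (2 * int n) = \<one>"
      using rel[of "replicate (2 * n) (GenA, True)" "[]"]
      unfolding val by (simp add: quat_relations_def flip: int_pow_int)
    show "b \<otimes> b = a [^] int n"
      using rel[of "replicate n (GenA, True)" "[(GenB, True), (GenB, True)]"] ab
      unfolding val by (simp add: quat_relations_def int_pow_int)
    have "inv b \<otimes> (a \<otimes> b) = inv a"
      using rel[of "[(GenB, False), (GenA, True), (GenB, True)]" "[(GenA, False)]"] ab
      by (simp add: quat_relations_def)
    \<comment> \<open>The conjugation relation is rearranged into the form that moves
      \<open>b\<close> rightwards past \<open>a\<close>.\<close>
    then have "a \<otimes> b = b \<otimes> inv a" using ab by (metis inv_closed inv_solve_left m_closed)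
    then have "b = inv a \<otimes> (b \<otimes> inv a)" using ab by (simp add: inv_solve_left)
    then have "b \<otimes> a = inv a \<otimes> (b \<otimes> inv a) \<otimes> a" by simp
    then show "b \<otimes> a = inv a \<otimes> b" using ab by (simp add: m_assoc)
  qed (use ab in auto)
  \<comment> \<open>A primitive 2n-th root of unity: its n-th power is -1 and no smaller positive
    power than the 2n-th is 1.\<close>
  define w where "w = cis (pi / n)"
  have w: "w * cnj w = 1" "w ^ n = - 1"
    using n by (simp_all add: w_def DeMoivre cis_cnj cis_mult)
  have rot_nat: "rot (int m) = word_val G ?f (replicate m (GenA, True))" for m
    by (simp add: val rot_def int_pow_int)
  have rot_periodic: "rot (2 * int n * c) = \<one>" for c
    using int_pow_pow[of a "2 * int n" c] a_pow by (simp add: rot_def)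
  \<comment> \<open>Exponents are made nonnegative modulo 2n, so that every rotation is the value of
    a word \<open>replicate m (GenA, True)\<close>.\<close>
  have rot_mod: "rot i = rot (int (nat (i mod (2 * int n))))" for i
  proof -
    have "i = 2 * int n * (i div (2 * int n)) + i mod (2 * int n)" by simp
    then have "rot i = rot (2 * int n * (i div (2 * int n))) \<otimes> rot (i mod (2 * int n))"
      unfolding rot_rot by simp
    then show ?thesis using n by (simp add: rot_periodic)
  qed
  have one_nat: "2 * n dvd m" if "rot (int m) = \<one>" for m
  proof -
    have "word_eq (quat_relations n) (replicate m (GenA, True)) []"
      using that word unfolding rot_nat by (metis word_val.simps(1))
    \<comment> \<open>The action on (1, 0) reads off \<open>w ^ m\<close>, so a trivial power of
      \<open>a\<close> forces m pi / n to be a multiple of 2 pi.\<close>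
    then have "(w ^ m * 1, cnj w ^ m * 0) = (1, 0)"
      using word_eq_action[OF w] word_action_replicate[of w m 1 0]
      by (metis foldr.simps(1) id_apply)
    then have "cis (m * (pi / n)) = 1" by (simp add: w_def DeMoivre)
    then have "cos (m * (pi / n)) = 1" by (metis cis.sel(1) one_complex.sel(1))
    then obtain c :: int where "m * (pi / n) = real_of_int c * 2 * pi" unfolding cos_one_2pi_int by blast
    then have "real m = real_of_int c * 2 * real n" using n by (simp add: field_simps)
    then have "real_of_int (int m) = real_of_int (2 * int n * c)" by simp
    then have "int m = 2 * int n * c" by (simp only: of_int_eq_iff)
    then have "int (2 * n) dvd int m" by simp
    then show ?thesis by (simp only: int_dvd_int_iff)
  qed
  show ?thesis
  proof unfold_locales
    show "0 < n" by (rule n)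
    fix i
    show "rot i = \<one> \<longleftrightarrow> 2 * int n dvd i"
    proof
      assume "rot i = \<one>"
      then have "2 * n dvd nat (i mod (2 * int n))" using one_nat rot_mod by metis
      then have "int (2 * n) dvd int (nat (i mod (2 * int n)))" by (simp only: int_dvd_int_iff)
      then show "2 * int n dvd i" using n by (simp add: dvd_mod_iff)
    next
      assume "2 * int n dvd i"
      then show "rot i = \<one>" using rot_periodic by blast
    qed
    show "b \<noteq> rot i"
    proof
      define m where "m = nat (i mod (2 * int n))"
      assume "b = rot i"
      then have "b = rot (int m)" using rot_mod unfolding m_def by metis
      then have "word_val G ?f [(GenB, True)] = word_val G ?f (replicate m (GenA, True))"
        using ab unfolding rot_nat by simp
      \<comment> \<open>\<open>b\<close> sends (1, 0) to (0, 1), whereas powers of \<open>a\<close>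
        act diagonally and keep the second coordinate 0.\<close>
      then have "foldr (letter_action w) [(GenB, True)] (1, 0) =
          foldr (letter_action w) (replicate m (GenA, True)) (1, 0)"
        using word_eq_action[OF w] word by metis
      then show False unfolding word_action_replicate by simp
    qed
    show "carrier G = range rot \<union> range flip"
      using generate_a_b unfolding gen by auto
  qed
qed

theorem theorem5p2:
  fixes G :: "('a, 'c) monoid_scheme" and a b :: 'a and n k :: nat and H :: "'a set"
  assumes "n \<ge> 2"
    and "generalized_quaternion G a b n"
    and "subgroup H G" and "H \<noteq> carrier G"
    and "1 \<le> k" and "k \<le> card H"
  shows "(even k \<longrightarrow> group_zero_regular_set G k H) \<and>
    (odd k \<longrightarrow>
      (group_zero_regular_set G k H \<longleftrightarrow>
        (\<exists>t. t dvd 2 * n \<and> odd (2 * n div t) \<and> H = generate G {a [^]\<^bsub>G\<^esub> t}) \<or>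
        (\<exists>t s. t dvd 2 * n \<and> odd t \<and> s \<le> t - 1 \<and>
           H = generate G {a [^]\<^bsub>G\<^esub> t, a [^]\<^bsub>G\<^esub> s \<otimes>\<^bsub>G\<^esub> b})))"
proof -
  interpret quaternion_group G a b n
    using generalized_quaternion_group assms(1,2) by fastforce
  show ?thesis by (rule regular_subgroup_classification[OF assms(3,4,6)])
qed

end
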